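(* Let $\epsilon>0$, $\lambda>0$, $h>0$. For $\eta\in\{\eta_J,\eta_m,\eta_v\}$ let $\widetilde{\mathcal{S}}(\omega,\boldsymbol{\theta})=I-\omega\,\widetilde{\mathcal{M}}(\boldsymbol{\theta})^{-1}\widetilde{\mathcal{L}}(\boldsymbol{\theta})$ be the symbol of the Braess-Sarazin-type relaxation (BSR) error operator for the marker-and-cell discretization of the linear elasticity problem in mixed form (with $\widetilde{\mathcal{L}}$, $\widetilde{\mathcal{M}}$, $\eta_J,\eta_m,\eta_v$ and $T^{\rm H}$ as defined in the context), and let $$\mu_{\rm opt}=\min_{\omega\in\mathbb{R}^+}\ \max_{\boldsymbol{\theta}\in T^{\rm H}}\ \rho\big(\widetilde{\mathcal{S}}(\omega,\boldsymbol{\theta})\big),$$ where $\rho$ denotes the spectral radius. Then: (i) (J-BSR, $\eta=\eta_J$) $\mu_{\rm opt}=\frac35$, and the minimum is uniquely achieved at $\omega=\frac45$. (ii) (Q-BSR, $\eta=\eta_m$) $\mu_{\rm opt}=\frac13$, and the minimum is uniquely achieved at $\omega=\frac34$. (iii) (V-BSR, $\eta=\eta_v$) $\mu_{\rm opt}=\frac{7}{25}$, and the minimum is uniquely achieved at $\omega=\frac{24}{25}$.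
   Context: The mixed linear elasticity system is $-\epsilon\Delta\boldsymbol{u}-\tau\nabla p=\boldsymbol{f}$, $\tau\nabla\cdot\boldsymbol{u}-\frac{\tau}{\lambda}p=0$ with Lamé constants $\lambda,\epsilon$ and $\tau=\frac{\lambda+\epsilon}{\lambda}$. It is discretized by the marker-and-cell (staggered finite difference) scheme on a uniform mesh of size $h$, giving the operator $\mathcal{L}=\begin{pmatrix}\mathcal{A}& B^T\\ B&-C\end{pmatrix}$, where $\mathcal{A}$ is $\epsilon$ times the block-diagonal five-point negative Laplacian. The BSR smoother is $\mathcal{M}=\begin{pmatrix}\epsilon D& B^T\\ B&-C\end{pmatrix}$, with relaxation error operator $\mathcal{S}=I-\omega\mathcal{M}^{-1}\mathcal{L}$ and damping parameter $\omega$. The block $D$ is block diagonal with two equal blocks: the diagonal of the five-point Laplacian (J-BSR); or the inverse of $Q=\frac{h^2}{36}\begin{bmatrix}1&4&1\\4&16&4\\1&4&1\end{bmatrix}$ (Q-BSR); or the inverse of $M_e=\frac{h^2}{96}\begin{bmatrix}1&4&1\\4&28&4\\1&4&1\end{bmatrix}$ (V-BSR). The symbol of a scalar stencil operator $L_hw(\boldsymbol{x})=\sum_{\boldsymbol{\kappa}}s_{\boldsymbol{\kappa}}w(\boldsymbol{x}+\boldsymbol{\kappa}h)$ is $\sum_{\boldsymbol{\kappa}}s_{\boldsymbol{\kappa}}e^{i\boldsymbol{\theta}\cdot\boldsymbol{\kappa}}$, where $i^2=-1$; symbols of block operators are formed blockwise. For $\boldsymbol{\theta}=(\theta_1,\theta_2)$,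 put $\chi=4-2\cos\theta_1-2\cos\theta_2$ and $$\eta_J=4,\qquad \eta_m=\frac{9}{4+2\cos\theta_1+2\cos\theta_2+\cos\theta_1\cos\theta_2},\qquad \eta_v=\frac{24}{7+2(\cos\theta_1+\cos\theta_2)+\cos\theta_1\cos\theta_2}.$$ The symbols are $$\widetilde{\mathcal{L}}(\boldsymbol{\theta})=\frac{1}{h^2}\begin{pmatrix}\epsilon\chi&0&-i\tau 2h\sin\frac{\theta_1}{2}\\0&\epsilon\chi&-i\tau 2h\sin\frac{\theta_2}{2}\\ i\tau 2h\sin\frac{\theta_1}{2}&i\tau 2h\sin\frac{\theta_2}{2}&-\frac{\tau}{\lambda}h^2\end{pmatrix},$$ $$\widetilde{\mathcal{M}}(\boldsymbol{\theta})=\frac{1}{h^2}\begin{pmatrix}\epsilon\eta&0&-i\tau 2h\sin\frac{\theta_1}{2}\\0&\epsilon\eta&-i\tau 2h\sin\frac{\theta_2}{2}\\ i\tau 2h\sin\frac{\theta_1}{2}&i\tau 2h\sin\frac{\theta_2}{2}&-\frac{\tau}{\lambda}h^2\end{pmatrix},$$ with $\eta=\eta_J$, $\eta_m$, $\eta_v$ for J-BSR, Q-BSR, V-BSR respectively. The set of high frequencies is $T^{\rm H}=\left(-\frac{\pi}{2},\frac{3\pi}{2}\right]^2\setminus\left(-\frac{\pi}{2},\frac{\pi}{2}\right]^2$. The quantity $\mu_{\rm opt}$ is called the optimal (local Fourier analysis) smoothing factor. *)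

theory Defs
  imports Complex_Main "Jordan_Normal_Form.Spectral_Radius"
begin

text \<open>
  For J-BSR, Q-BSR and V-BSR the symbol of the block \<open>D\<close> of the smoother is \<open>\<eta> / h\<^sup>2\<close>.
  For Q-BSR and V-BSR this is the reciprocal of the symbol of the stencil \<open>Q\<close> and \<open>M\<^sub>e\<close>:
  summing the nine stencil entries against their exponentials gives
  \<open>h\<^sup>2 / 36 * (16 + 8 cos \<theta>\<^sub>1 + 8 cos \<theta>\<^sub>2 + 4 cos \<theta>\<^sub>1 cos \<theta>\<^sub>2)\<close> and
  \<open>h\<^sup>2 / 96 * (28 + 8 cos \<theta>\<^sub>1 + 8 cos \<theta>\<^sub>2 + 4 cos \<theta>\<^sub>1 cos \<theta>\<^sub>2)\<close>.
\<close>

definition eta_J :: "real \<times> real \<Rightarrow> real" where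
  "eta_J \<theta> = 4"

definition eta_m :: "real \<times> real \<Rightarrow> real" where
  "eta_m \<theta> = 9 / (4 + 2 * cos (fst \<theta>) + 2 * cos (snd \<theta>) + cos (fst \<theta>) * cos (snd \<theta>))"

definition eta_v :: "real \<times> real \<Rightarrow> real" where
  "eta_v \<theta> = 24 / (7 + 2 * (cos (fst \<theta>) + cos (snd \<theta>)) + cos (fst \<theta>) * cos (snd \<theta>))"

definition chi :: "real \<times> real \<Rightarrow> real" where
  "chi \<theta> = 4 - 2 * cos (fst \<theta>) - 2 * cos (snd \<theta>)"

definition tau :: "real \<Rightarrow> real \<Rightarrow> real" where
  "tau \<epsilon> lam = (lam + \<epsilon>) / lam"

text \<open>
  The symbols of \<open>\<L>\<close> and \<open>\<M>\<close> differ only in the factor of \<open>\<epsilon>\<close> in the leading block, here the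
  parameter \<open>d\<close>. The Lame constant \<open>\<lambda>\<close> is written \<open>lam\<close>.
\<close>

definition saddle_symbol ::
  "real \<Rightarrow> real \<Rightarrow> real \<Rightarrow> real \<Rightarrow> real \<times> real \<Rightarrow> complex mat" where
  "saddle_symbol \<epsilon> lam h d \<theta> =
    (let s1 = \<i> * complex_of_real (tau \<epsilon> lam * 2 * h * sin (fst \<theta> / 2));
         s2 = \<i> * complex_of_real (tau \<epsilon> lam * 2 * h * sin (snd \<theta> / 2))
     in complex_of_real (1 / h\<^sup>2) \<cdot>\<^sub>m mat_of_rows_list 3
       [[complex_of_real (\<epsilon> * d), 0, - s1],
        [0, complex_of_real (\<epsilon> * d), - s2],
        [s1, s2, - complex_of_real (tau \<epsilon> lam / lam * h\<^sup>2)]])"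

definition L_symbol :: "real \<Rightarrow> real \<Rightarrow> real \<Rightarrow> real \<times> real \<Rightarrow> complex mat" where
  "L_symbol \<epsilon> lam h \<theta> = saddle_symbol \<epsilon> lam h (chi \<theta>) \<theta>"

definition M_symbol ::
  "real \<Rightarrow> real \<Rightarrow> real \<Rightarrow> (real \<times> real \<Rightarrow> real) \<Rightarrow> real \<times> real \<Rightarrow> complex mat" where
  "M_symbol \<epsilon> lam h \<eta> \<theta> = saddle_symbol \<epsilon> lam h (\<eta> \<theta>) \<theta>"

text \<open>
  \<open>mat_inverse\<close> returns \<open>None\<close> on singular matrices; lemma \<open>mat_inverse_M_symbol\<close> below
  shows that this case does not occur.
\<close>

definition S_symbol ::
  "real \<Rightarrow> real \<Rightarrow> real \<Rightarrow> (real \<times> real \<Rightarrow> real) \<Rightarrow> real \<Rightarrow> real \<times> real \<Rightarrow> complex mat" where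
  "S_symbol \<epsilon> lam h \<eta> \<omega> \<theta> =
     1\<^sub>m 3 - complex_of_real \<omega> \<cdot>\<^sub>m (the (mat_inverse (M_symbol \<epsilon> lam h \<eta> \<theta>)) * L_symbol \<epsilon> lam h \<theta>)"

definition high_freqs :: "(real \<times> real) set" where
  "high_freqs = ({- (pi / 2)<..3 * pi / 2} \<times> {- (pi / 2)<..3 * pi / 2})
                 - ({- (pi / 2)<..pi / 2} \<times> {- (pi / 2)<..pi / 2})"

text \<open>
  On the reals \<open>SUP\<close> and \<open>INF\<close> carry information only for bounded sets. Attainment of the
  maximum over \<open>high_freqs\<close> and of the minimum over \<open>\<omega> > 0\<close> has to be stated separately.
\<close>

definition smoothing_factor ::
  "real \<Rightarrow> real \<Rightarrow> real \<Rightarrow> (real \<times> real \<Rightarrow> real) \<Rightarrow> real \<Rightarrow> real" where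
  "smoothing_factor \<epsilon> lam h \<eta> \<omega> = (SUP \<theta>\<in>high_freqs. spectral_radius (S_symbol \<epsilon> lam h \<eta> \<omega> \<theta>))"

definition mu_opt :: "real \<Rightarrow> real \<Rightarrow> real \<Rightarrow> (real \<times> real \<Rightarrow> real) \<Rightarrow> real" where
  "mu_opt \<epsilon> lam h \<eta> = (INF \<omega>\<in>{0<..}. smoothing_factor \<epsilon> lam h \<eta> \<omega>)"

lemma eta_pos: "\<eta> \<in> {eta_J, eta_m, eta_v} \<Longrightarrow> \<eta> \<theta> > 0"
proof -
  assume \<eta>: "\<eta> \<in> {eta_J, eta_m, eta_v}"
  define a b where "a = cos (fst \<theta>)" and "b = cos (snd \<theta>)"
  have ab: "a \<ge> -1" "b \<ge> -1" by (auto simp: a_def b_def)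
  have "0 < (2 + a) * (2 + b)" using ab by (intro mult_pos_pos) auto
  then have m: "0 < 4 + 2 * a + 2 * b + a * b" by (simp add: algebra_simps)
  then have "0 < 7 + 2 * (a + b) + a * b" by simp
  with m \<eta> show ?thesis by (auto simp: eta_J_def eta_m_def eta_v_def a_def b_def)
qed

lemma mat_inverse_M_symbol:
  assumes pos: "\<epsilon> > 0" "lam > 0" "h > 0" and \<eta>: "\<eta> \<in> {eta_J, eta_m, eta_v}"
  obtains B where "mat_inverse (M_symbol \<epsilon> lam h \<eta> \<theta>) = Some B"
    "M_symbol \<epsilon> lam h \<eta> \<theta> * B = 1\<^sub>m 3" "B * M_symbol \<epsilon> lam h \<eta> \<theta> = 1\<^sub>m 3"
    "B \<in> carrier_mat 3 3"
proof -
  let ?M = "M_symbol \<epsilon> lam h \<eta> \<theta>"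
  define a p q c where "a = \<epsilon> * \<eta> \<theta>" and "p = tau \<epsilon> lam * 2 * h * sin (fst \<theta> / 2)"
    and "q = tau \<epsilon> lam * 2 * h * sin (snd \<theta> / 2)" and "c = tau \<epsilon> lam / lam * h\<^sup>2"
  define N where "N = mat_of_rows_list 3
       [[complex_of_real a, 0, - (\<i> * complex_of_real p)],
        [0, complex_of_real a, - (\<i> * complex_of_real q)],
        [\<i> * complex_of_real p, \<i> * complex_of_real q, - complex_of_real c]]"
  have M: "?M = complex_of_real (1 / h\<^sup>2) \<cdot>\<^sub>m N"
    unfolding M_symbol_def saddle_symbol_def Let_def N_def a_def p_def q_def c_def ..
  have N: "N \<in> carrier_mat 3 3" by (auto simp: N_def mat_of_rows_list_def intro!: carrier_matI)
  have "a > 0" using pos eta_pos[OF \<eta>] by (simp add: a_def)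
  moreover have "c > 0" using pos by (simp add: c_def tau_def)
  ultimately have ne: "a * (a * c + p\<^sup>2 + q\<^sup>2) > 0"
    by (intro mult_pos_pos add_pos_nonneg) auto
  have det2: "det (mat 2 2 f) = f (0,0) * f (1,1) - f (0,1) * f (1,0)" for f :: "nat \<times> nat \<Rightarrow> complex"
    by (subst laplace_expansion_column[of _ 2 0])
       (auto simp: cofactor_def mat_delete_def det_single numeral_2_eq_2)
  have det3: "det (mat 3 3 f) = f (0,0) * (f (1,1) * f (2,2) - f (1,2) * f (2,1))
      - f (1,0) * (f (0,1) * f (2,2) - f (0,2) * f (2,1))
      + f (2,0) * (f (0,1) * f (1,2) - f (0,2) * f (1,1))" for f :: "nat \<times> nat \<Rightarrow> complex"
  proof -
    have set3: "{..<3::nat} = {0, 1, 2}" and two: "Suc (Suc 0) = 2" by auto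
    show ?thesis
      by (subst laplace_expansion_column[of _ 3 0])
         (simp_all add: set3 cofactor_def mat_delete_def det2 two algebra_simps)
  qed
  have "det N = - complex_of_real (a * (a * c + p\<^sup>2 + q\<^sup>2))"
    unfolding N_def mat_of_rows_list_def
    by (simp add: det3 power2_eq_square algebra_simps flip: numeral_3_eq_3)
  then have "det N \<noteq> 0" using ne by (metis less_irrefl neg_equal_0_iff_equal of_real_eq_0_iff)
  then have "det ?M \<noteq> 0" using pos by (simp add: M)
  moreover have M3: "?M \<in> carrier_mat 3 3" using N by (simp add: M)
  ultimately have "mat_inverse ?M \<noteq> None"
    using det_non_zero_imp_unit[OF M3, of "()"] mat_inverse(1)[OF M3, of "()"] by auto
  then show thesis using mat_inverse(2)[OF M3] that by auto
qed

end

theory Submission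
  imports Defs
begin

text \<open>
  The spectrum can be found without computing \<open>M\<^sup>-\<^sup>1\<close>. A number \<open>k\<close> is an eigenvalue of \<open>1 - \<omega> M\<^sup>-\<^sup>1 L\<close> iff
  \<open>(1 - k) M - \<omega> L\<close> is singular, and this pencil is again a saddle-point matrix of the same
  shape, because \<open>L\<close> and \<open>M\<close> differ only in their leading block. Its determinant splits into three
  linear factors, so the eigenvalues are \<open>1 - \<omega> x\<close> with \<open>x\<close> equal to \<open>1\<close>, to \<open>\<chi> / \<eta>\<close>, or to a
  third ratio \<open>y\<close> that comes from the pressure and depends on \<open>\<epsilon>\<close> and \<open>\<lambda>\<close>. The sign of the
  pressure block makes \<open>y\<close> a convex combination of \<open>1\<close> and \<open>\<chi> / \<eta>\<close>
  (\<open>pressure_ratio_damping_le\<close>). It therefore never determines the spectral radius, which is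
  \<open>max \<bar>1 - \<omega>\<bar> \<bar>1 - \<omega> \<chi> / \<eta>\<bar>\<close>; this is why the optimal factors do not depend on the Lame
  constants or on the mesh size.

  Over the high frequencies \<open>\<chi> / \<eta>\<close> has least value \<open>m\<close> and greatest value \<open>M\<close>, both attained, with
  \<open>m \<le> 1 \<le> M\<close>. Hence the eigenvalue \<open>1 - \<omega>\<close> is dominated too, and the smoothing factor is
  \<open>max \<bar>1 - \<omega> m\<bar> \<bar>1 - \<omega> M\<bar>\<close>. This is smallest exactly when the two deviations balance, at
  \<open>\<omega> = 2 / (M + m)\<close>, with value \<open>(M - m) / (M + m)\<close> (\<open>smoothing_minimax\<close>).

  It remains to find \<open>m\<close> and \<open>M\<close>. In \<open>a = cos \<theta>\<^sub>1\<close> and \<open>b = cos \<theta>\<^sub>2\<close> the high frequencies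
  are the part of the square \<open>[-1, 1]\<^sup>2\<close> where \<open>a\<close> or \<open>b\<close> is at most \<open>0\<close>, and \<open>\<chi> / \<eta>\<close> is a polynomial
  there, affine for J-BSR and cubic for the other two. Its range is \<open>[1/2, 2]\<close> for J-BSR,
  \<open>[8/9, 16/9]\<close> for Q-BSR and \<open>[3/4, 4/3]\<close> for V-BSR (\<open>damped_ratio_bounds\<close>,
  \<open>damped_ratio_extremes\<close>).
\<close>

section \<open>The spectrum of the error symbol\<close>

lemma det_mat_2: "det (mat 2 2 f) = f (0,0) * f (1,1) - f (0,1) * f (1,0)"
  for f :: "nat \<times> nat \<Rightarrow> 'a :: comm_ring_1"
  by (subst laplace_expansion_column[of _ 2 0])
     (auto simp: cofactor_def mat_delete_def det_single numeral_2_eq_2)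

lemma det_mat_3: "det (mat 3 3 f) = f (0,0) * (f (1,1) * f (2,2) - f (1,2) * f (2,1))
      - f (1,0) * (f (0,1) * f (2,2) - f (0,2) * f (2,1))
      + f (2,0) * (f (0,1) * f (1,2) - f (0,2) * f (1,1))"
  for f :: "nat \<times> nat \<Rightarrow> 'a :: comm_ring_1"
proof -
  have set3: "{..<3::nat} = {0, 1, 2}" and two: "Suc (Suc 0) = 2" by auto
  show ?thesis
    by (subst laplace_expansion_column[of _ 3 0])
       (simp_all add: set3 cofactor_def mat_delete_def det_mat_2 two algebra_simps)
qed

definition saddle_mat :: "'a \<Rightarrow> 'a \<Rightarrow> 'a \<Rightarrow> 'a \<Rightarrow> 'a :: comm_ring_1 mat" where
  "saddle_mat a p q c = mat_of_rows_list 3 [[a, 0, - p], [0, a, - q], [p, q, - c]]"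

lemma saddle_mat_carrier [simp]: "saddle_mat a p q c \<in> carrier_mat 3 3"
  by (auto simp: saddle_mat_def mat_of_rows_list_def intro!: carrier_matI)

lemma det_saddle_mat: "det (saddle_mat a p q c) = - a * (a * c - p\<^sup>2 - q\<^sup>2)"
  unfolding saddle_mat_def mat_of_rows_list_def
  by (simp add: det_mat_3 power2_eq_square algebra_simps flip: numeral_3_eq_3)

lemma saddle_symbol_eq:
  "saddle_symbol \<epsilon> lam h d \<theta> = complex_of_real (1 / h\<^sup>2) \<cdot>\<^sub>m
     saddle_mat (complex_of_real (\<epsilon> * d))
       (\<i> * complex_of_real (tau \<epsilon> lam * 2 * h * sin (fst \<theta> / 2)))
       (\<i> * complex_of_real (tau \<epsilon> lam * 2 * h * sin (snd \<theta> / 2)))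
       (complex_of_real (tau \<epsilon> lam / lam * h\<^sup>2))"
  by (simp add: saddle_symbol_def saddle_mat_def Let_def)

lemma chi_half_angle: "chi \<theta> = 4 * (sin (fst \<theta> / 2))\<^sup>2 + 4 * (sin (snd \<theta> / 2))\<^sup>2"
  using cos_double_sin[of "fst \<theta> / 2"] cos_double_sin[of "snd \<theta> / 2"] by (simp add: chi_def)

lemma chi_nonneg: "chi \<theta> \<ge> 0"
  by (simp add: chi_half_angle)

text \<open>
  Multiplying \<open>1 - k - w B L\<close> from the left by the invertible matrix \<open>M\<close> replaces the inverse \<open>B\<close>
  by the pencil of \<open>M\<close> and \<open>L\<close>.
\<close>

lemma eigenvalue_one_minus_iff:
  fixes M L B :: "'a :: field mat"
  assumes M: "M \<in> carrier_mat n n" and L: "L \<in> carrier_mat n n" and B: "B \<in> carrier_mat n n"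
    and MB: "M * B = 1\<^sub>m n"
  shows "eigenvalue (1\<^sub>m n - w \<cdot>\<^sub>m (B * L)) k \<longleftrightarrow> det ((1 - k) \<cdot>\<^sub>m M - w \<cdot>\<^sub>m L) = 0"
proof -
  let ?S = "1\<^sub>m n - w \<cdot>\<^sub>m (B * L)"
  let ?N = "(1 - k) \<cdot>\<^sub>m 1\<^sub>m n - w \<cdot>\<^sub>m (B * L)"
  have BL: "B * L \<in> carrier_mat n n" using B L by simp
  have S: "?S \<in> carrier_mat n n" using BL by (intro minus_carrier_mat smult_carrier_mat)
  have N: "?N \<in> carrier_mat n n" using BL by (intro minus_carrier_mat smult_carrier_mat)
  have "det M * det B = 1" using MB det_mult[OF M B] by simp
  then have detM: "det M \<noteq> 0" by auto
  have "char_matrix ?S k = ?N"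
    unfolding char_matrix_def by (rule eq_matI) (use B L in \<open>auto simp: algebra_simps\<close>)
  then have "eigenvalue ?S k \<longleftrightarrow> det ?N = 0"
    using eigenvalue_det[OF S] by simp
  also have "\<dots> \<longleftrightarrow> det (M * ?N) = 0"
    using detM det_mult[OF M N] by simp
  also have "M * ?N = (1 - k) \<cdot>\<^sub>m (M * 1\<^sub>m n) - w \<cdot>\<^sub>m (M * (B * L))"
    using M BL by (subst mult_minus_distrib_mat[of _ n n _ n])
      (simp_all add: mult_smult_distrib[of M n n _ n])
  also have "M * (B * L) = L"
    using assoc_mult_mat[OF M B L] MB L by simp
  finally show ?thesis using M by simp
qed

text \<open>
  The eigenvalue of \<open>M\<^sup>-\<^sup>1 L\<close> on discretely divergence-free velocities, on which the coupling
  blocks vanish and only \<open>\<epsilon> \<chi>\<close> is compared with \<open>\<epsilon> \<eta>\<close>.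
\<close>

definition damped_ratio :: "(real \<times> real \<Rightarrow> real) \<Rightarrow> real \<times> real \<Rightarrow> real" where
  "damped_ratio \<eta> \<theta> = chi \<theta> / \<eta> \<theta>"

text \<open>
  The eigenvalue of \<open>M\<^sup>-\<^sup>1 L\<close> produced by the coupling of the pressure with the gradient part of the
  velocity. The fraction has been cleared of the denominator \<open>\<lambda>\<close>, and \<open>\<tau>\<close> has been eliminated through
  \<open>\<lambda> \<tau> = \<lambda> + \<epsilon>\<close>.
\<close>

definition pressure_ratio :: "real \<Rightarrow> real \<Rightarrow> (real \<times> real \<Rightarrow> real) \<Rightarrow> real \<times> real \<Rightarrow> real" where
  "pressure_ratio \<epsilon> lam \<eta> \<theta> = (2 * \<epsilon> + lam) * chi \<theta> / (\<epsilon> * \<eta> \<theta> + (lam + \<epsilon>) * chi \<theta>)"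

text \<open>
  With \<open>z = 1 - k\<close> the pencil \<open>z M - \<omega> L\<close> has leading entries proportional to \<open>z \<eta> - \<omega> \<chi>\<close>, while
  all its other entries carry the common factor \<open>z - \<omega>\<close>. Each of these two factors splits off
  from the determinant. What remains is linear in \<open>z\<close>, and since the squared couplings add up to a
  multiple of \<open>\<chi>\<close>, its root depends on the frequency only through \<open>\<chi>\<close> and \<open>\<eta>\<close>.
\<close>

lemma spectrum_S_symbol:
  assumes pos: "\<epsilon> > 0" "lam > 0" "h > 0" and \<eta>: "\<eta> \<in> {eta_J, eta_m, eta_v}"
  shows "spectrum (S_symbol \<epsilon> lam h \<eta> \<omega> \<theta>) = (\<lambda>x. complex_of_real (1 - \<omega> * x)) `
           {1, damped_ratio \<eta> \<theta>, pressure_ratio \<epsilon> lam \<eta> \<theta>}"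
proof -
  let ?M = "M_symbol \<epsilon> lam h \<eta> \<theta>" and ?L = "L_symbol \<epsilon> lam h \<theta>"
  obtain B where B: "mat_inverse ?M = Some B" "?M * B = 1\<^sub>m 3" "B \<in> carrier_mat 3 3"
    using mat_inverse_M_symbol[OF pos \<eta>] by metis
  have carr: "?M \<in> carrier_mat 3 3" "?L \<in> carrier_mat 3 3"
    by (simp_all add: M_symbol_def L_symbol_def saddle_symbol_eq)
  have h0: "h\<^sup>2 > 0" and \<tau>: "tau \<epsilon> lam > 0" using pos by (simp_all add: tau_def)
  have e: "\<eta> \<theta> > 0" by (rule eta_pos[OF \<eta>])
  define g where "g = \<epsilon> * \<eta> \<theta> + (lam + \<epsilon>) * chi \<theta>"
  have g: "g > 0" unfolding g_def using pos e chi_nonneg[of \<theta>] by (intro add_pos_nonneg) auto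
  have "eigenvalue (S_symbol \<epsilon> lam h \<eta> \<omega> \<theta>) k \<longleftrightarrow>
     k \<in> (\<lambda>x. complex_of_real (1 - \<omega> * x)) ` {1, damped_ratio \<eta> \<theta>, pressure_ratio \<epsilon> lam \<eta> \<theta>}" for k
  proof -
    define H E X T P Q z w where
      "H = complex_of_real (1 / h\<^sup>2)" and "E = complex_of_real (\<eta> \<theta>)"
      and "X = complex_of_real (chi \<theta>)" and "T = complex_of_real (tau \<epsilon> lam / lam * h\<^sup>2)"
      and "P = \<i> * complex_of_real (tau \<epsilon> lam * 2 * h * sin (fst \<theta> / 2))"
      and "Q = \<i> * complex_of_real (tau \<epsilon> lam * 2 * h * sin (snd \<theta> / 2))"
      and "z = 1 - k" and "w = complex_of_real \<omega>"
    define F where "F = z * E - w * X"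
    have [simp]: "H \<noteq> 0" using h0 by (simp add: H_def)
    have symbols: "?M = H \<cdot>\<^sub>m saddle_mat (\<epsilon> * E) P Q T" "?L = H \<cdot>\<^sub>m saddle_mat (\<epsilon> * X) P Q T"
      by (simp_all add: M_symbol_def L_symbol_def saddle_symbol_eq H_def E_def X_def T_def P_def Q_def)
    \<comment> \<open>The divergence of the gradient is the same five-point Laplacian, so \<open>\<chi>\<close> reappears here.\<close>
    have PQ: "P\<^sup>2 + Q\<^sup>2 = - complex_of_real ((tau \<epsilon> lam)\<^sup>2 * h\<^sup>2 * chi \<theta>)"
      by (simp add: P_def Q_def chi_half_angle power_mult_distrib algebra_simps)
    have comb: "z \<cdot>\<^sub>m ?M - w \<cdot>\<^sub>m ?L =
        H \<cdot>\<^sub>m saddle_mat (\<epsilon> * F) ((z - w) * P) ((z - w) * Q) ((z - w) * T)"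
      unfolding symbols F_def
      by (rule eq_matI)
         (auto simp: saddle_mat_def mat_of_rows_list_def less_Suc_eq numeral_3_eq_3 algebra_simps)
    have "dim_col (saddle_mat a p q c) = 3" for a p q c :: complex
      using saddle_mat_carrier by (rule carrier_matD)
    then have det: "det (z \<cdot>\<^sub>m ?M - w \<cdot>\<^sub>m ?L) =
        - (H ^ 3) * (\<epsilon> * F) * (z - w) * (\<epsilon> * F * T - (z - w) * (P\<^sup>2 + Q\<^sup>2))"
      by (simp add: comb det_smult det_saddle_mat power_mult_distrib algebra_simps power2_eq_square)
    have lt: "lam * tau \<epsilon> lam = lam + \<epsilon>" using pos by (simp add: tau_def)
    define u where "u = tau \<epsilon> lam / lam * h\<^sup>2"
    have u: "u > 0" using pos \<tau> by (simp add: u_def)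
    have "(tau \<epsilon> lam)\<^sup>2 * h\<^sup>2 * chi \<theta> = u * (lam * tau \<epsilon> lam) * chi \<theta>"
      using pos by (simp add: u_def power2_eq_square)
    then have "complex_of_real ((tau \<epsilon> lam)\<^sup>2 * h\<^sup>2 * chi \<theta>) =
        complex_of_real (u * (lam * tau \<epsilon> lam) * chi \<theta>)" by (rule arg_cong)
    then have PQ': "P\<^sup>2 + Q\<^sup>2 = - (complex_of_real u * complex_of_real (lam + \<epsilon>) * X)"
      unfolding PQ lt X_def of_real_mult by simp
    have third: "\<epsilon> * F * T - (z - w) * (P\<^sup>2 + Q\<^sup>2) = u * (z * g - w * ((2 * \<epsilon> + lam) * chi \<theta>))"
      unfolding PQ' F_def T_def u_def[symmetric] g_def E_def X_def by (simp add: algebra_simps)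
    have "eigenvalue (S_symbol \<epsilon> lam h \<eta> \<omega> \<theta>) k \<longleftrightarrow> det (z \<cdot>\<^sub>m ?M - w \<cdot>\<^sub>m ?L) = 0"
      using eigenvalue_one_minus_iff[OF carr B(3,2)] B(1) by (simp add: S_symbol_def z_def w_def)
    also have "\<dots> \<longleftrightarrow> z = w \<or> z * E = w * X \<or> z * g = w * ((2 * \<epsilon> + lam) * chi \<theta>)"
      unfolding det third using pos u by (simp add: F_def) blast
    also have "\<dots> \<longleftrightarrow> z = w \<or> z = w * damped_ratio \<eta> \<theta> \<or> z = w * pressure_ratio \<epsilon> lam \<eta> \<theta>"
    proof -
      have "chi \<theta> = damped_ratio \<eta> \<theta> * \<eta> \<theta>" using e by (simp add: damped_ratio_def)
      then have "X = complex_of_real (damped_ratio \<eta> \<theta>) * E"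
        unfolding X_def E_def of_real_mult[symmetric] by (rule arg_cong)
      moreover have "(2 * \<epsilon> + lam) * chi \<theta> = pressure_ratio \<epsilon> lam \<eta> \<theta> * g"
        using g by (simp add: pressure_ratio_def g_def[symmetric])
      moreover have "E \<noteq> 0" "complex_of_real g \<noteq> 0" using e g by (simp_all add: E_def)
      ultimately show ?thesis by (simp flip: mult.assoc)
    qed
    also have "\<dots> \<longleftrightarrow> k \<in> (\<lambda>x. complex_of_real (1 - \<omega> * x)) `
                       {1, damped_ratio \<eta> \<theta>, pressure_ratio \<epsilon> lam \<eta> \<theta>}"
      by (auto simp: z_def w_def algebra_simps)
    finally show ?thesis .
  qed
  then show ?thesis unfolding spectrum_def by blast
qed

text \<open>
  The pressure ratio is the mean of \<open>\<chi> / \<eta>\<close> and \<open>1\<close> with nonnegative weights \<open>\<epsilon> \<eta>\<close> and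
  \<open>(\<lambda> + \<epsilon>) \<chi>\<close>, and \<open>x \<mapsto> \<bar>1 - \<omega> x\<bar>\<close> is convex.
\<close>

lemma pressure_ratio_damping_le:
  assumes pos: "\<epsilon> > 0" "lam > 0" and e: "\<eta> \<theta> > 0"
  shows "\<bar>1 - \<omega> * pressure_ratio \<epsilon> lam \<eta> \<theta>\<bar> \<le> max \<bar>1 - \<omega>\<bar> \<bar>1 - \<omega> * damped_ratio \<eta> \<theta>\<bar>"
proof -
  define g where "g = \<epsilon> * \<eta> \<theta> + (lam + \<epsilon>) * chi \<theta>"
  define t where "t = \<epsilon> * \<eta> \<theta> / g"
  let ?x = "damped_ratio \<eta> \<theta>" and ?R = "max \<bar>1 - \<omega>\<bar> \<bar>1 - \<omega> * damped_ratio \<eta> \<theta>\<bar>"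
  have g: "g > 0" unfolding g_def using pos e chi_nonneg[of \<theta>] by (intro add_pos_nonneg) auto
  have "t \<ge> 0" using pos e g by (simp add: t_def)
  have "1 - t = (lam + \<epsilon>) * chi \<theta> / g" using g by (simp add: t_def g_def field_simps)
  then have "1 - t \<ge> 0" using pos g chi_nonneg[of \<theta>] by simp
  have "t * ?x = \<epsilon> * chi \<theta> / g" using e by (simp add: t_def damped_ratio_def)
  then have mix: "pressure_ratio \<epsilon> lam \<eta> \<theta> = t * ?x + (1 - t)"
    unfolding \<open>1 - t = _\<close> pressure_ratio_def g_def[symmetric]
    by (simp add: distrib_right flip: add_divide_distrib)
  have "1 - \<omega> * pressure_ratio \<epsilon> lam \<eta> \<theta> = t * (1 - \<omega> * ?x) + (1 - t) * (1 - \<omega>)"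
    unfolding mix by (simp add: algebra_simps)
  with \<open>t \<ge> 0\<close> \<open>1 - t \<ge> 0\<close>
  have "\<bar>1 - \<omega> * pressure_ratio \<epsilon> lam \<eta> \<theta>\<bar> \<le> t * \<bar>1 - \<omega> * ?x\<bar> + (1 - t) * \<bar>1 - \<omega>\<bar>"
    by (metis abs_mult abs_of_nonneg abs_triangle_ineq)
  also have "\<dots> \<le> t * ?R + (1 - t) * ?R"
    using \<open>t \<ge> 0\<close> \<open>1 - t \<ge> 0\<close> by (intro add_mono mult_left_mono) auto
  finally show ?thesis by (simp add: algebra_simps)
qed

lemma spectral_radius_S_symbol:
  assumes pos: "\<epsilon> > 0" "lam > 0" "h > 0" and \<eta>: "\<eta> \<in> {eta_J, eta_m, eta_v}"
  shows "spectral_radius (S_symbol \<epsilon> lam h \<eta> \<omega> \<theta>)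
           = max \<bar>1 - \<omega>\<bar> \<bar>1 - \<omega> * damped_ratio \<eta> \<theta>\<bar>"
proof -
  have "norm ` spectrum (S_symbol \<epsilon> lam h \<eta> \<omega> \<theta>)
      = (\<lambda>x. \<bar>1 - \<omega> * x\<bar>) ` {1, damped_ratio \<eta> \<theta>, pressure_ratio \<epsilon> lam \<eta> \<theta>}"
    unfolding spectrum_S_symbol[OF pos \<eta>] image_image norm_of_real ..
  moreover have "\<bar>1 - \<omega> * pressure_ratio \<epsilon> lam \<eta> \<theta>\<bar> \<le> max \<bar>1 - \<omega>\<bar> \<bar>1 - \<omega> * damped_ratio \<eta> \<theta>\<bar>"
    using pos eta_pos[OF \<eta>] by (intro pressure_ratio_damping_le)
  ultimately show ?thesis
    unfolding spectral_radius_def by (auto intro!: Max_eqI simp: max_def)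
qed

section \<open>Optimal damping of an interval of ratios\<close>

lemma damping_interval_le:
  fixes m M x \<omega> :: real
  assumes "m \<le> x" "x \<le> M"
  shows "\<bar>1 - \<omega> * x\<bar> \<le> max \<bar>1 - \<omega> * m\<bar> \<bar>1 - \<omega> * M\<bar>"
proof (cases "\<omega> \<ge> 0")
  case True
  then have "\<omega> * m \<le> \<omega> * x" "\<omega> * x \<le> \<omega> * M" using assms by (auto intro: mult_left_mono)
  then show ?thesis by auto
next
  case False
  then have "\<omega> * M \<le> \<omega> * x" "\<omega> * x \<le> \<omega> * m" using assms by (auto intro: mult_left_mono_neg)
  then show ?thesis by auto
qed

text \<open>
  In the combination \<open>M (1 - \<omega> m) - m (1 - \<omega> M) = M - m\<close> the damping parameter cancels, so the
  two deviations cannot both be small.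
\<close>

lemma endpoint_damping_ge:
  fixes m M \<omega> :: real
  assumes "0 < m" "m < M"
  shows "(M - m) / (M + m) \<le> max \<bar>1 - \<omega> * m\<bar> \<bar>1 - \<omega> * M\<bar>"
proof -
  let ?R = "max \<bar>1 - \<omega> * m\<bar> \<bar>1 - \<omega> * M\<bar>"
  have "M - m = M * (1 - \<omega> * m) + m * (\<omega> * M - 1)" by (simp add: algebra_simps)
  also have "\<dots> \<le> M * ?R + m * ?R" using assms by (intro add_mono mult_left_mono) auto
  finally have "M - m \<le> ?R * (M + m)" by (simp add: algebra_simps)
  then show ?thesis using assms by (simp add: pos_divide_le_eq)
qed

text \<open>
  If neither deviation exceeds \<open>(M - m) / (M + m)\<close>, then the bound on \<open>1 - \<omega> m\<close> gives
  \<open>\<omega> (M + m) \<ge> 2\<close> and the bound on \<open>\<omega> M - 1\<close> gives \<open>\<omega> (M + m) \<le> 2\<close>.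
\<close>

lemma endpoint_damping_eq_iff:
  fixes m M \<omega> :: real
  assumes "0 < m" "m < M"
  shows "max \<bar>1 - \<omega> * m\<bar> \<bar>1 - \<omega> * M\<bar> = (M - m) / (M + m) \<longleftrightarrow> \<omega> = 2 / (M + m)"
proof
  assume "\<omega> = 2 / (M + m)"
  then have "\<omega> * (M + m) = 2" using assms by (metis add_pos_pos less_trans nonzero_divide_eq_eq order_less_irrefl)
  moreover have "(1 - \<omega> * m) * (M + m) = M + m - \<omega> * (M + m) * m"
    "(1 - \<omega> * M) * (M + m) = M + m - \<omega> * (M + m) * M"
    by (simp_all add: algebra_simps)
  ultimately have "(1 - \<omega> * m) * (M + m) = M - m" "(1 - \<omega> * M) * (M + m) = - (M - m)"
    by simp_all
  then have "1 - \<omega> * m = (M - m) / (M + m)" "1 - \<omega> * M = - (M - m) / (M + m)"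
    using assms by (simp_all add: eq_divide_eq)
  then show "max \<bar>1 - \<omega> * m\<bar> \<bar>1 - \<omega> * M\<bar> = (M - m) / (M + m)" using assms by simp
next
  assume eq: "max \<bar>1 - \<omega> * m\<bar> \<bar>1 - \<omega> * M\<bar> = (M - m) / (M + m)"
  then have "1 - \<omega> * m \<le> (M - m) / (M + m)" "\<omega> * M - 1 \<le> (M - m) / (M + m)" by linarith+
  moreover have "M + m > 0" using assms by simp
  ultimately have "(1 - \<omega> * m) * (M + m) \<le> M - m" "(\<omega> * M - 1) * (M + m) \<le> M - m"
    by (blast intro: iffD1[OF pos_le_divide_eq])+
  then have "(\<omega> * (M + m) - 2) * m \<ge> 0" "(\<omega> * (M + m) - 2) * M \<le> 0"
    by (simp_all add: algebra_simps)
  then have "\<omega> * (M + m) - 2 = 0"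
    using assms by (simp add: zero_le_mult_iff mult_le_0_iff)
  then show "\<omega> = 2 / (M + m)" using assms by (simp add: eq_divide_eq)
qed

text \<open>
  Since \<open>1\<close> lies in \<open>[m, M]\<close>, the eigenvalue \<open>1 - \<omega>\<close> is covered by the interval as well, so for every
  \<open>\<omega>\<close> the spectral radius is maximal at \<open>\<alpha>\<close> or at \<open>\<beta>\<close>. The properties of the supremum and the
  infimum then follow from attainment.
\<close>

lemma smoothing_minimax:
  assumes pos: "\<epsilon> > 0" "lam > 0" "h > 0" and \<eta>: "\<eta> \<in> {eta_J, eta_m, eta_v}"
    and mM: "0 < m" "m < M" "m \<le> 1" "1 \<le> M"
    and range: "\<And>\<theta>. \<theta> \<in> high_freqs \<Longrightarrow> m \<le> damped_ratio \<eta> \<theta> \<and> damped_ratio \<eta> \<theta> \<le> M"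
    and low: "\<alpha> \<in> high_freqs" "damped_ratio \<eta> \<alpha> = m"
    and high: "\<beta> \<in> high_freqs" "damped_ratio \<eta> \<beta> = M"
  shows "\<exists>\<theta>\<in>high_freqs. \<forall>\<theta>'\<in>high_freqs.
           spectral_radius (S_symbol \<epsilon> lam h \<eta> \<omega> \<theta>') \<le> spectral_radius (S_symbol \<epsilon> lam h \<eta> \<omega> \<theta>)"
    and "mu_opt \<epsilon> lam h \<eta> = (M - m) / (M + m)"
    and "smoothing_factor \<epsilon> lam h \<eta> \<omega> = mu_opt \<epsilon> lam h \<eta> \<longleftrightarrow> \<omega> = 2 / (M + m)"
proof -
  let ?\<rho> = "\<lambda>\<omega> \<theta>. spectral_radius (S_symbol \<epsilon> lam h \<eta> \<omega> \<theta>)"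
  let ?R = "\<lambda>\<omega>. max \<bar>1 - \<omega> * m\<bar> \<bar>1 - \<omega> * M\<bar>"
  note \<rho> = spectral_radius_S_symbol[OF pos \<eta>]
  have le: "?\<rho> \<omega> \<theta> \<le> ?R \<omega>" if "\<theta> \<in> high_freqs" for \<omega> \<theta>
    using damping_interval_le[of m 1 M \<omega>] damping_interval_le[of m "damped_ratio \<eta> \<theta>" M \<omega>]
      range[OF that] mM by (simp add: \<rho>)
  have att: "\<exists>\<theta>\<in>high_freqs. ?\<rho> \<omega> \<theta> = ?R \<omega>" for \<omega>
  proof -
    have "?R \<omega> \<le> ?\<rho> \<omega> \<alpha> \<or> ?R \<omega> \<le> ?\<rho> \<omega> \<beta>" using low high by (auto simp: \<rho>)
    then show ?thesis using le low(1) high(1) by (meson order_antisym)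
  qed
  show "\<exists>\<theta>\<in>high_freqs. \<forall>\<theta>'\<in>high_freqs. ?\<rho> \<omega> \<theta>' \<le> ?\<rho> \<omega> \<theta>"
    using att[of \<omega>] le by metis
  have sf: "smoothing_factor \<epsilon> lam h \<eta> \<omega> = ?R \<omega>" for \<omega>
    unfolding smoothing_factor_def
  proof (rule cSup_eq_maximum)
    show "?R \<omega> \<in> ?\<rho> \<omega> ` high_freqs" using att[of \<omega>] by (metis imageI)
    show "y \<le> ?R \<omega>" if "y \<in> ?\<rho> \<omega> ` high_freqs" for y using that le by auto
  qed
  have eq: "?R \<omega> = (M - m) / (M + m) \<longleftrightarrow> \<omega> = 2 / (M + m)" for \<omega>
    by (rule endpoint_damping_eq_iff[OF mM(1,2)])
  show mu: "mu_opt \<epsilon> lam h \<eta> = (M - m) / (M + m)"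
    unfolding mu_opt_def sf
  proof (rule cInf_eq_minimum)
    have "2 / (M + m) > 0" using mM by simp
    moreover have "?R (2 / (M + m)) = (M - m) / (M + m)" unfolding eq ..
    ultimately show "(M - m) / (M + m) \<in> ?R ` {0<..}"
      by (intro image_eqI[of _ _ "2 / (M + m)"]) simp_all
    show "(M - m) / (M + m) \<le> y" if "y \<in> ?R ` {0<..}" for y
      using that endpoint_damping_ge[OF mM(1,2)] by auto
  qed
  show "smoothing_factor \<epsilon> lam h \<eta> \<omega> = mu_opt \<epsilon> lam h \<eta> \<longleftrightarrow> \<omega> = 2 / (M + m)"
    unfolding sf mu by (rule eq)
qed

section \<open>The range of the ratio over the high frequencies\<close>

lemma cos_nonpos_middle:
  assumes "pi / 2 \<le> x" "x \<le> 3 * pi / 2"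
  shows "cos x \<le> 0"
proof -
  have "0 \<le> cos (x - pi)" using assms by (intro cos_ge_zero) auto
  then show ?thesis by (simp add: cos_diff)
qed

lemma high_freqs_cos_nonpos: "\<theta> \<in> high_freqs \<Longrightarrow> cos (fst \<theta>) \<le> 0 \<or> cos (snd \<theta>) \<le> 0"
  using cos_nonpos_middle[of "fst \<theta>"] cos_nonpos_middle[of "snd \<theta>"]
  by (cases \<theta>) (auto simp: high_freqs_def)

text \<open>
  These points attain the extreme ratios. The angle \<open>3 \<pi> / 2\<close> supplies the cosine \<open>0\<close>, since
  \<open>(\<pi> / 2, 0)\<close> and \<open>(\<pi> / 2, \<pi> / 2)\<close> are low frequencies.
\<close>

lemma extremal_high_freqs:
  "(3 * pi / 2, 0) \<in> high_freqs" "(3 * pi / 2, 3 * pi / 2) \<in> high_freqs" "(pi, pi) \<in> high_freqs"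
  using pi_gt_zero by (simp_all add: high_freqs_def less_trans[of _ 0])

lemma cos_three_half_pi: "cos (3 * pi / 2) = 0"
  using cos_3over2_pi by (simp add: mult.commute)

text \<open>
  The coefficient of \<open>b\<^sup>2\<close> is \<open>- 2 (2 + a)\<close> in both cubics, so they are concave in \<open>b\<close> and lie above
  their chord between \<open>b = -1\<close> and \<open>b = 0\<close>. On these two edges the bounds are quadratic inequalities
  in \<open>a\<close>.
\<close>

lemma cubic_lower_bound:
  fixes a b :: real
  assumes "-1 \<le> a" "a \<le> 1" "-1 \<le> b" "b \<le> 0"
  shows "8 \<le> (4 - 2 * a - 2 * b) * ((2 + a) * (2 + b))"
    and "18 \<le> (4 - 2 * a - 2 * b) * (7 + 2 * (a + b) + a * b)"
proof -
  \<comment> \<open>The height of each cubic above its chord; the chord has weights \<open>1 + b\<close> at \<open>0\<close> and \<open>- b\<close> at \<open>-1\<close>.\<close>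
  have mid: "0 \<le> 2 * (2 + a) * (- b) * (1 + b)" using assms by (intro mult_nonneg_nonneg) auto
  have "0 \<le> 4 * ((1 - a) * (1 + a)) + 4" "0 \<le> 2 * ((2 - a) * (1 + a))"
    using assms by simp_all
  then have "0 \<le> (1 + b) * (4 * ((1 - a) * (1 + a)) + 4)" "0 \<le> - b * (2 * ((2 - a) * (1 + a)))"
    using assms by (intro mult_nonneg_nonneg; simp)+
  with mid show "8 \<le> (4 - 2 * a - 2 * b) * ((2 + a) * (2 + b))"
    by (simp add: algebra_simps)
  have "0 \<le> 2 * ((1 - a) * (5 + 2 * a))" "0 \<le> 2 * ((1 - a) * (3 + a)) + 6"
    using assms by simp_all
  then have "0 \<le> (1 + b) * (2 * ((1 - a) * (5 + 2 * a)))" "0 \<le> - b * (2 * ((1 - a) * (3 + a)) + 6)"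
    using assms by (intro mult_nonneg_nonneg; simp)+
  with mid show "18 \<le> (4 - 2 * a - 2 * b) * (7 + 2 * (a + b) + a * b)"
    by (simp add: algebra_simps)
qed

text \<open>
  For a fixed sum \<open>a + b\<close> both cubics are largest on the diagonal \<open>a = b\<close>, because
  \<open>4 a b = (a + b)\<^sup>2 - (a - b)\<^sup>2\<close>. On the diagonal the difference to the bound factors, with its
  zero at \<open>a + b = 0\<close> for the first cubic and at \<open>a + b = -2\<close> for the second.
\<close>

lemma cubic_upper_bound:
  fixes a b :: real
  assumes "-1 \<le> a" "a \<le> 1" "-1 \<le> b" "b \<le> 1"
  shows "(4 - 2 * a - 2 * b) * ((2 + a) * (2 + b)) \<le> 16"
    and "(4 - 2 * a - 2 * b) * (7 + 2 * (a + b) + a * b) \<le> 32"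
proof -
  have diag: "0 \<le> (4 - 2 * a - 2 * b) * (a - b)\<^sup>2 / 4" using assms by simp
  have "0 \<le> (a + b)\<^sup>2 * (a + b + 6) / 2" using assms by simp
  moreover have "16 - (4 - 2 * a - 2 * b) * ((2 + a) * (2 + b))
      = (a + b)\<^sup>2 * (a + b + 6) / 2 + (4 - 2 * a - 2 * b) * (a - b)\<^sup>2 / 4"
    by (simp add: field_simps power2_eq_square)
  ultimately show "(4 - 2 * a - 2 * b) * ((2 + a) * (2 + b)) \<le> 16" using diag by linarith
  have "0 \<le> (a + b + 2) ^ 3 / 2" using assms by simp
  moreover have "32 - (4 - 2 * a - 2 * b) * (7 + 2 * (a + b) + a * b)
      = (a + b + 2) ^ 3 / 2 + (4 - 2 * a - 2 * b) * (a - b)\<^sup>2 / 4"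
    by (simp add: field_simps power2_eq_square power3_eq_cube)
  ultimately show "(4 - 2 * a - 2 * b) * (7 + 2 * (a + b) + a * b) \<le> 32" using diag by linarith
qed

lemma damped_ratio_eqs:
  "damped_ratio eta_J \<theta> = (4 - 2 * cos (fst \<theta>) - 2 * cos (snd \<theta>)) / 4"
  "damped_ratio eta_m \<theta> =
     (4 - 2 * cos (fst \<theta>) - 2 * cos (snd \<theta>)) * ((2 + cos (fst \<theta>)) * (2 + cos (snd \<theta>))) / 9"
  "damped_ratio eta_v \<theta> = (4 - 2 * cos (fst \<theta>) - 2 * cos (snd \<theta>)) *
     (7 + 2 * (cos (fst \<theta>) + cos (snd \<theta>)) + cos (fst \<theta>) * cos (snd \<theta>)) / 24"
proof -
  show "damped_ratio eta_J \<theta> = (4 - 2 * cos (fst \<theta>) - 2 * cos (snd \<theta>)) / 4"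
    by (simp add: damped_ratio_def chi_def eta_J_def)
  have "4 + 2 * a + 2 * b + a * b = (2 + a) * (2 + b)" for a b :: real
    by (simp add: algebra_simps)
  then show "damped_ratio eta_m \<theta> =
     (4 - 2 * cos (fst \<theta>) - 2 * cos (snd \<theta>)) * ((2 + cos (fst \<theta>)) * (2 + cos (snd \<theta>))) / 9"
    by (simp add: damped_ratio_def chi_def eta_m_def)
  show "damped_ratio eta_v \<theta> = (4 - 2 * cos (fst \<theta>) - 2 * cos (snd \<theta>)) *
     (7 + 2 * (cos (fst \<theta>) + cos (snd \<theta>)) + cos (fst \<theta>) * cos (snd \<theta>)) / 24"
    by (simp add: damped_ratio_def chi_def eta_v_def)
qed

text \<open>
  The cubics are symmetric in the two cosines, so the nonpositive one may be taken to be the second.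
\<close>

lemma damped_ratio_bounds:
  assumes "\<theta> \<in> high_freqs"
  shows "1 / 2 \<le> damped_ratio eta_J \<theta> \<and> damped_ratio eta_J \<theta> \<le> 2"
    and "8 / 9 \<le> damped_ratio eta_m \<theta> \<and> damped_ratio eta_m \<theta> \<le> 16 / 9"
    and "3 / 4 \<le> damped_ratio eta_v \<theta> \<and> damped_ratio eta_v \<theta> \<le> 4 / 3"
proof -
  define a b where "a = cos (fst \<theta>)" and "b = cos (snd \<theta>)"
  have ab: "-1 \<le> a" "a \<le> 1" "-1 \<le> b" "b \<le> 1" by (auto simp: a_def b_def)
  have neg: "a \<le> 0 \<or> b \<le> 0" using high_freqs_cos_nonpos[OF assms] by (simp add: a_def b_def)
  show "1 / 2 \<le> damped_ratio eta_J \<theta> \<and> damped_ratio eta_J \<theta> \<le> 2"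
    unfolding damped_ratio_eqs a_def[symmetric] b_def[symmetric] using ab neg by auto
  have "8 \<le> (4 - 2 * a - 2 * b) * ((2 + a) * (2 + b))"
    using neg cubic_lower_bound(1)[of a b] cubic_lower_bound(1)[of b a] ab
    by (auto simp: algebra_simps)
  then show "8 / 9 \<le> damped_ratio eta_m \<theta> \<and> damped_ratio eta_m \<theta> \<le> 16 / 9"
    unfolding damped_ratio_eqs a_def[symmetric] b_def[symmetric]
    using cubic_upper_bound(1)[OF ab] by simp
  have "18 \<le> (4 - 2 * a - 2 * b) * (7 + 2 * (a + b) + a * b)"
    using neg cubic_lower_bound(2)[of a b] cubic_lower_bound(2)[of b a] ab
    by (auto simp: algebra_simps)
  then show "3 / 4 \<le> damped_ratio eta_v \<theta> \<and> damped_ratio eta_v \<theta> \<le> 4 / 3"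
    unfolding damped_ratio_eqs a_def[symmetric] b_def[symmetric]
    using cubic_upper_bound(2)[OF ab] by simp
qed

lemma damped_ratio_extremes:
  "damped_ratio eta_J (3 * pi / 2, 0) = 1 / 2" "damped_ratio eta_J (pi, pi) = 2"
  "damped_ratio eta_m (pi, pi) = 8 / 9" "damped_ratio eta_m (3 * pi / 2, 3 * pi / 2) = 16 / 9"
  "damped_ratio eta_v (3 * pi / 2, 0) = 3 / 4" "damped_ratio eta_v (pi, pi) = 4 / 3"
  by (simp_all add: damped_ratio_eqs cos_three_half_pi)

theorem theorem3p2:
  fixes \<epsilon> lam h :: real
  assumes "\<epsilon> > 0" and "lam > 0" and "h > 0"
  shows "(\<forall>\<eta>\<in>{eta_J, eta_m, eta_v}. \<forall>\<omega>>0. \<exists>\<theta>\<in>high_freqs. \<forall>\<theta>'\<in>high_freqs.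
            spectral_radius (S_symbol \<epsilon> lam h \<eta> \<omega> \<theta>') \<le> spectral_radius (S_symbol \<epsilon> lam h \<eta> \<omega> \<theta>))
    \<and> (mu_opt \<epsilon> lam h eta_J = 3 / 5
        \<and> (\<forall>\<omega>>0. smoothing_factor \<epsilon> lam h eta_J \<omega> = mu_opt \<epsilon> lam h eta_J \<longleftrightarrow> \<omega> = 4 / 5))
    \<and> (mu_opt \<epsilon> lam h eta_m = 1 / 3
        \<and> (\<forall>\<omega>>0. smoothing_factor \<epsilon> lam h eta_m \<omega> = mu_opt \<epsilon> lam h eta_m \<longleftrightarrow> \<omega> = 3 / 4))
    \<and> (mu_opt \<epsilon> lam h eta_v = 7 / 25
        \<and> (\<forall>\<omega>>0. smoothing_factor \<epsilon> lam h eta_v \<omega> = mu_opt \<epsilon> lam h eta_v \<longleftrightarrow> \<omega> = 24 / 25))"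
proof -
  note J = smoothing_minimax[OF assms _ _ _ _ _ damped_ratio_bounds(1)
      extremal_high_freqs(1) damped_ratio_extremes(1) extremal_high_freqs(3) damped_ratio_extremes(2)]
  note Q = smoothing_minimax[OF assms _ _ _ _ _ damped_ratio_bounds(2)
      extremal_high_freqs(3) damped_ratio_extremes(3) extremal_high_freqs(2) damped_ratio_extremes(4)]
  note V = smoothing_minimax[OF assms _ _ _ _ _ damped_ratio_bounds(3)
      extremal_high_freqs(1) damped_ratio_extremes(5) extremal_high_freqs(3) damped_ratio_extremes(6)]
  let ?max_attained = "\<lambda>\<eta>. \<forall>\<omega>>0. \<exists>\<theta>\<in>high_freqs. \<forall>\<theta>'\<in>high_freqs.
      spectral_radius (S_symbol \<epsilon> lam h \<eta> \<omega> \<theta>') \<le> spectral_radius (S_symbol \<epsilon> lam h \<eta> \<omega> \<theta>)"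
  have "?max_attained eta_J" by (intro allI impI J(1)) simp_all
  moreover have "?max_attained eta_m" by (intro allI impI Q(1)) simp_all
  moreover have "?max_attained eta_v" by (intro allI impI V(1)) simp_all
  moreover have "mu_opt \<epsilon> lam h eta_J = 3 / 5" by (subst J(2)) simp_all
  moreover have "mu_opt \<epsilon> lam h eta_m = 1 / 3" by (subst Q(2)) simp_all
  moreover have "mu_opt \<epsilon> lam h eta_v = 7 / 25" by (subst V(2)) simp_all
  moreover have "smoothing_factor \<epsilon> lam h eta_J \<omega> = mu_opt \<epsilon> lam h eta_J \<longleftrightarrow> \<omega> = 4 / 5" for \<omega>
    by (subst J(3)) simp_all
  moreover have "smoothing_factor \<epsilon> lam h eta_m \<omega> = mu_opt \<epsilon> lam h eta_m \<longleftrightarrow> \<omega> = 3 / 4" for \<omega>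
    by (subst Q(3)) simp_all
  moreover have "smoothing_factor \<epsilon> lam h eta_v \<omega> = mu_opt \<epsilon> lam h eta_v \<longleftrightarrow> \<omega> = 24 / 25" for \<omega>
    by (subst V(3)) simp_all
  ultimately show ?thesis by blast
qed

end
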